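(* Let $a,b,c,d,e,v,w,x,y,z$ be ten distinct spin orbitals, and let $\eta_1,\eta_2$ be two further distinct (ancilla) spin orbitals. Let $\theta\in\mathbb{R}$. Let $$\ket{\Psi}=\xi_1\ket{abcde}+\xi_2\ket{ab\phi_1\phi_2\phi_3}+\xi_3\ket{cde\phi_4\phi_5}+\xi_4\ket{vwxyz},$$ where $\xi_1,\dots,\xi_4$ are arbitrary coefficients and $\phi_1,\dots,\phi_5$ are orbitals not in $\{a,b,c,d,e,v,w,x,y,z,\eta_1,\eta_2\}$, with $\phi_1,\phi_2,\phi_3$ distinct and $\phi_4\ne\phi_5$ (so the ancilla orbitals are empty in $\ket{\Psi}$). Then $$U^{ab}_{v\eta_1}(\tfrac{\pi}{2})\,U^{cde}_{xy\eta_2}(\tfrac{\pi}{2})\,C_{vxy}U^{wz}_{\eta_1\eta_2}(\theta)\,U^{xy\eta_2}_{cde}(\tfrac{\pi}{2})\,U^{v\eta_1}_{ab}(\tfrac{\pi}{2})\ket{\Psi}=e^{\theta\left(\hat A_{abcde}^{vwxyz}-(\hat A_{abcde}^{vwxyz})^\dagger\right)}\ket{\Psi},$$ and both sides equal $$\xi_1(\cos\theta\ket{abcde}+\sin\theta\ket{vwxyz})+\xi_2\ket{ab\phi_1\phi_2\phi_3}+\xi_3\ket{cde\phi_4\phi_5}+\xi_4(\cos\theta\ket{vwxyz}-\sin\theta\ket{abcde}).$$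
   Context: Work in the fermionic Fock space over a finite set of spin orbitals with creation and annihilation operators $\hat a_p^\dagger,\hat a_p$ satisfying $\{\hat a_p,\hat a_q\}=0$, $\{\hat a_p^\dagger,\hat a_q^\dagger\}=0$, $\{\hat a_p,\hat a_q^\dagger\}=\delta_{pq}$, vacuum $\ket{\mathrm{vac}}$ and number operators $\hat n_p=\hat a_p^\dagger\hat a_p$. A ket listing orbitals denotes the determinant $\ket{p_1p_2\cdots p_m}=\hat a_{p_1}^\dagger\hat a_{p_2}^\dagger\cdots\hat a_{p_m}^\dagger\ket{\mathrm{vac}}$; all orbitals not listed are empty. For disjoint lists of distinct orbitals $i_1,\dots,i_n$ and $p_1,\dots,p_n$, the rank-$n$ excitation operator is $\hat A_{i_1\cdots i_n}^{p_1\cdots p_n}=\hat a_{p_1}^\dagger\hat a_{p_2}^\dagger\cdots\hat a_{p_n}^\dagger\,\hat a_{i_n}\cdots\hat a_{i_2}\hat a_{i_1}$. The corresponding unitary coupled-cluster (UCC) factor with angle $\theta$ is $U_{i_1\cdots i_n}^{p_1\cdots p_n}(\theta)=\exp\!\big(\theta[\hat A_{i_1\cdots i_n}^{p_1\cdots p_n}-(\hat A_{i_1\cdots i_n}^{p_1\cdots p_n})^\dagger]\big)$. The controlled factor $C_{q_1\cdots q_k}U_{i_1\cdots i_n}^{p_1\cdots p_n}(\theta)$, with control orbitals $q_1,\dots,q_k$ distinct from all $i$'s and $p$'s, acts as $U_{i_1\cdots i_n}^{p_1\cdots p_n}(\theta)$ on determinants in which all of $q_1,\dots,q_k$ are occupied,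 and as the identity on all other determinants; equivalently it is $\exp\!\big(\theta\,\hat n_{q_1}\cdots\hat n_{q_k}[\hat A_{i_1\cdots i_n}^{p_1\cdots p_n}-(\hat A_{i_1\cdots i_n}^{p_1\cdots p_n})^\dagger]\big)$. *)

theory Defs
  imports "HOL-Analysis.Analysis"
begin

text \<open>
  The fermionic Fock space over a finite type of spin orbitals: amplitudes indexed by occupation
  sets. The linear order on the orbitals only fixes the (Jordan--Wigner) sign convention that
  realises the anticommutation relations; the basis vector \<^term>\<open>axis S 1\<close> is the determinant
  in which the orbitals of \<^term>\<open>S\<close> are listed increasingly.
\<close>

type_synonym 'o fock = "(complex, 'o set) vec"

definition jw_sign :: "'o::{finite,linorder} \<Rightarrow> 'o set \<Rightarrow> complex" where
  "jw_sign p S = (- 1) ^ card {q \<in> S. q < p}"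

definition annihilate :: "'o::{finite,linorder} \<Rightarrow> 'o fock \<Rightarrow> 'o fock" where
  "annihilate p \<psi> = (\<chi> S. if p \<notin> S then jw_sign p S * \<psi> $ insert p S else 0)"

definition create :: "'o::{finite,linorder} \<Rightarrow> 'o fock \<Rightarrow> 'o fock" where
  "create p \<psi> = (\<chi> S. if p \<in> S then jw_sign p S * \<psi> $ (S - {p}) else 0)"

definition vacuum :: "'o::finite fock" where
  "vacuum = axis {} 1"

definition number_op :: "'o::{finite,linorder} \<Rightarrow> 'o fock \<Rightarrow> 'o fock" where
  "number_op p \<psi> = create p (annihilate p \<psi>)"

definition ket :: "'o::{finite,linorder} list \<Rightarrow> 'o fock" where
  "ket ps = foldr create ps vacuum"

definition fock_inner :: "'o::finite fock \<Rightarrow> 'o fock \<Rightarrow> complex" where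
  "fock_inner \<phi> \<psi> = (\<Sum>S\<in>UNIV. cnj (\<phi> $ S) * \<psi> $ S)"

text \<open>The conjugate transpose; see \<open>fock_inner_adjoint\<close> below.\<close>

definition fock_adjoint :: "('o::finite fock \<Rightarrow> 'o fock) \<Rightarrow> 'o fock \<Rightarrow> 'o fock" where
  "fock_adjoint T \<psi> = (\<chi> S. fock_inner (T (axis S 1)) \<psi>)"

text \<open>The exponential series of an operator; it converges for every linear operator
  (\<open>op_exp_sums\<close> below).\<close>

definition op_exp :: "('o::finite fock \<Rightarrow> 'o fock) \<Rightarrow> 'o fock \<Rightarrow> 'o fock" where
  "op_exp T \<psi> = (\<Sum>n. (T ^^ n) \<psi> /\<^sub>R fact n)"

text \<open>In all operators below, the first list \<open>is\<close> holds the lower indices (orbitals to be emptied)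
  and the second list \<open>ps\<close> the upper indices (orbitals to be filled).\<close>

definition excitation :: "'o::{finite,linorder} list \<Rightarrow> 'o list \<Rightarrow> 'o fock \<Rightarrow> 'o fock" where
  "excitation is ps \<psi> = foldr create ps (foldr annihilate (rev is) \<psi>)"

definition ucc :: "'o::{finite,linorder} list \<Rightarrow> 'o list \<Rightarrow> real \<Rightarrow> 'o fock \<Rightarrow> 'o fock" where
  "ucc is ps \<theta> =
     op_exp (\<lambda>\<psi>. \<theta> *\<^sub>R (excitation is ps \<psi> - fock_adjoint (excitation is ps) \<psi>))"

definition controlled_ucc ::
  "'o::{finite,linorder} list \<Rightarrow> 'o list \<Rightarrow> 'o list \<Rightarrow> real \<Rightarrow> 'o fock \<Rightarrow> 'o fock" where
  "controlled_ucc qs is ps \<theta> =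
     op_exp (\<lambda>\<psi>. \<theta> *\<^sub>R foldr number_op qs
       (excitation is ps \<psi> - fock_adjoint (excitation is ps) \<psi>))"


subsection \<open>The canonical anticommutation relations\<close>

lemma jw_sign_insert:
  assumes "q \<notin> S"
  shows "jw_sign p (insert q S) = (if q < p then - jw_sign p S else jw_sign p S)"
proof -
  have *: "{r \<in> insert q S. r < p} = (if q < p then insert q {r \<in> S. r < p} else {r \<in> S. r < p})"
    by auto
  show ?thesis unfolding jw_sign_def * using assms by simp
qed

lemma jw_sign_delete:
  assumes "q \<in> S"
  shows "jw_sign p (S - {q}) = (if q < p then - jw_sign p S else jw_sign p S)"
proof -
  have "jw_sign p S = jw_sign p (insert q (S - {q}))"
    using assms by (simp add: insert_absorb)
  then show ?thesis using jw_sign_insert[of q "S - {q}" p] by auto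
qed

lemma jw_sign_square [simp]: "jw_sign p S * jw_sign p S = 1"
  by (simp add: jw_sign_def flip: power_add)

lemma jw_sign_cancel [simp]: "jw_sign p S * (jw_sign p S * z) = z"
  by (simp flip: mult.assoc)

lemma annihilate_anticommute: "annihilate p (annihilate q \<psi>) + annihilate q (annihilate p \<psi>) = 0"
proof (cases p q rule: linorder_cases)
  case less
  then show ?thesis
    by (auto simp: vec_eq_iff annihilate_def jw_sign_insert insert_commute)
next
  case equal
  then show ?thesis by (auto simp: vec_eq_iff annihilate_def)
next
  case greater
  then show ?thesis
    by (auto simp: vec_eq_iff annihilate_def jw_sign_insert insert_commute)
qed

lemma create_anticommute: "create p (create q \<psi>) + create q (create p \<psi>) = 0"
proof -
  have *: "S - {p} - {q} = S - {q} - {p}" for S by auto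
  show ?thesis
  proof (cases p q rule: linorder_cases)
    case less
    then show ?thesis
      by (auto simp: vec_eq_iff create_def jw_sign_delete *)
  next
    case equal
    then show ?thesis by (auto simp: vec_eq_iff create_def)
  next
    case greater
    then show ?thesis
      by (auto simp: vec_eq_iff create_def jw_sign_delete *)
  qed
qed

lemma annihilate_create_anticommute:
  "annihilate p (create q \<psi>) + create q (annihilate p \<psi>) = (if p = q then \<psi> else 0)"
proof (cases p q rule: linorder_cases)
  case less
  then show ?thesis
    by (auto simp: vec_eq_iff annihilate_def create_def jw_sign_insert jw_sign_delete
        insert_Diff_if)
next
  case equal
  then show ?thesis
    by (auto simp: vec_eq_iff annihilate_def create_def jw_sign_insert jw_sign_delete
        insert_absorb)
next
  case greater
  then show ?thesis
    by (auto simp: vec_eq_iff annihilate_def create_def jw_sign_insert jw_sign_delete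
        insert_Diff_if)
qed

lemma annihilate_vacuum: "annihilate p vacuum = 0"
  by (auto simp: vec_eq_iff annihilate_def vacuum_def axis_def)


subsection \<open>Adjoints and exponentials\<close>

lemma fock_inner_adjoint:
  assumes "Vector_Spaces.linear (*s) (*s) T"
  shows "fock_inner (T \<phi>) \<psi> = fock_inner \<phi> (fock_adjoint T \<psi>)"
proof -
  interpret T: Vector_Spaces.linear "(*s)" "(*s)" T by fact
  have "T \<phi> = T (\<Sum>S\<in>UNIV. \<phi> $ S *s axis S 1)"
    by (simp add: basis_expansion)
  also have "\<dots> = (\<Sum>S\<in>UNIV. \<phi> $ S *s T (axis S 1))"
    by (simp add: T.sum T.scale)
  finally have *: "T \<phi> $ R = (\<Sum>S\<in>UNIV. \<phi> $ S * T (axis S 1) $ R)" for R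
    by simp
  show ?thesis
    unfolding fock_inner_def fock_adjoint_def *
    by (simp add: sum_distrib_left sum_distrib_right mult.assoc) (rule sum.swap)
qed

lemma fock_adjoint_annihilate: "fock_adjoint (annihilate p) = create p"
proof
  fix \<psi> :: "'a fock"
  have "fock_adjoint (annihilate p) \<psi> $ S = create p \<psi> $ S" for S
  proof -
    have "annihilate p (axis S 1) $ R = (if p \<in> S \<and> R = S - {p} then jw_sign p S else 0)" for R
      by (auto simp: annihilate_def axis_def jw_sign_insert)
    moreover have "cnj (jw_sign p S) = jw_sign p S" by (simp add: jw_sign_def)
    ultimately have "cnj (annihilate p (axis S 1) $ R) * \<psi> $ R =
        (if R = S - {p} then (if p \<in> S then jw_sign p S * \<psi> $ (S - {p}) else 0) else 0)" for R
      by simp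
    then show ?thesis by (simp add: fock_adjoint_def fock_inner_def create_def)
  qed
  then show "fock_adjoint (annihilate p) \<psi> = create p \<psi>" by (simp add: vec_eq_iff)
qed

lemma op_exp_sums:
  assumes "linear T"
  shows "(\<lambda>n. (T ^^ n) \<psi> /\<^sub>R fact n) sums op_exp T \<psi>"
proof -
  have "bounded_linear T" using assms linear_conv_bounded_linear by blast
  then obtain K where K: "K > 0" "\<And>x. norm (T x) \<le> norm x * K"
    using bounded_linear.pos_bounded by blast
  have *: "norm ((T ^^ n) \<psi>) \<le> K ^ n * norm \<psi>" for n
  proof (induction n)
    case (Suc n)
    have "norm ((T ^^ Suc n) \<psi>) \<le> norm ((T ^^ n) \<psi>) * K" using K(2) by simp
    also have "\<dots> \<le> K ^ n * norm \<psi> * K" using Suc K(1) by (intro mult_right_mono) auto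
    finally show ?case by (simp add: mult_ac)
  qed simp
  have "summable (\<lambda>n. norm \<psi> * (K ^ n /\<^sub>R fact n))"
    by (intro summable_mult summable_exp_generic)
  then have "summable (\<lambda>n. (T ^^ n) \<psi> /\<^sub>R fact n)"
    by (rule summable_comparison_test'[where N = 0])
      (use * in \<open>auto simp: field_simps\<close>)
  then show ?thesis by (simp add: op_exp_def summable_sums)
qed


subsection \<open>The controlled factor acts as the plain factor exactly on the controlled determinants\<close>

definition sector :: "('o set \<Rightarrow> bool) \<Rightarrow> 'o::finite fock set" where
  "sector K = {\<psi>. \<forall>S. \<not> K S \<longrightarrow> \<psi> $ S = 0}"

lemma number_op_nth: "number_op p \<psi> $ S = (if p \<in> S then \<psi> $ S else 0)"
  by (auto simp: number_op_def create_def annihilate_def jw_sign_delete insert_absorb)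

lemma foldr_number_op_nth: "foldr number_op qs \<psi> $ S = (if set qs \<subseteq> S then \<psi> $ S else 0)"
  by (induction qs) (auto simp: number_op_nth)

lemma sector_foldr_create:
  assumes "\<And>p S. p \<in> set ps \<Longrightarrow> K (insert p S) = K (S - {p})" "\<psi> \<in> sector K"
  shows "foldr create ps \<psi> \<in> sector K"
  using assms
proof (induction ps)
  case (Cons p ps)
  have "K (insert p S) = K (S - {p})" for S using Cons.prems(1) by simp
  then have "K S = K (S - {p})" if "p \<in> S" for S by (metis insert_absorb that)
  moreover have "foldr create ps \<psi> \<in> sector K" using Cons by simp
  ultimately show ?case by (simp add: sector_def create_def[of p])
qed simp

lemma sector_foldr_annihilate:
  assumes "\<And>p S. p \<in> set ps \<Longrightarrow> K (insert p S) = K (S - {p})" "\<psi> \<in> sector K"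
  shows "foldr annihilate ps \<psi> \<in> sector K"
  using assms
proof (induction ps)
  case (Cons p ps)
  have "K (insert p S) = K (S - {p})" for S using Cons.prems(1) by simp
  then have "K (insert p S) = K S" if "p \<notin> S" for S using that by simp
  moreover have "foldr annihilate ps \<psi> \<in> sector K" using Cons by simp
  ultimately show ?case by (simp add: sector_def annihilate_def[of p])
qed simp

lemma sector_excitation:
  assumes "\<And>p S. p \<in> set is \<union> set ps \<Longrightarrow> K (insert p S) = K (S - {p})" "\<psi> \<in> sector K"
  shows "excitation is ps \<psi> \<in> sector K"
  unfolding excitation_def
  by (intro sector_foldr_create sector_foldr_annihilate) (use assms in auto)

lemma sector_adjoint:
  assumes "\<And>\<psi>. \<psi> \<in> sector (\<lambda>S. \<not> K S) \<Longrightarrow> T \<psi> \<in> sector (\<lambda>S. \<not> K S)" "\<psi> \<in> sector K"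
  shows "fock_adjoint T \<psi> \<in> sector K"
proof -
  have "fock_adjoint T \<psi> $ S = 0" if "\<not> K S" for S
  proof -
    have "axis S 1 \<in> sector (\<lambda>S. \<not> K S)" using that by (auto simp: sector_def axis_def)
    then have "T (axis S 1) \<in> sector (\<lambda>S. \<not> K S)" by (rule assms)
    then have "cnj (T (axis S 1) $ R) * \<psi> $ R = 0" for R
      using assms(2) by (cases "K R") (auto simp: sector_def)
    then show ?thesis
      by (simp only: fock_adjoint_def fock_inner_def vec_lambda_beta sum.neutral_const)
  qed
  then show ?thesis by (simp add: sector_def)
qed

lemma sector_generator:
  assumes "\<And>p S. p \<in> set is \<union> set ps \<Longrightarrow> K (insert p S) = K (S - {p})" "\<psi> \<in> sector K"
  shows "excitation is ps \<psi> - fock_adjoint (excitation is ps) \<psi> \<in> sector K"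
proof -
  have "excitation is ps \<psi> \<in> sector K" using assms by (rule sector_excitation)
  moreover have "fock_adjoint (excitation is ps) \<psi> \<in> sector K"
    by (rule sector_adjoint[OF sector_excitation]) (use assms in auto)
  ultimately show ?thesis by (simp add: sector_def)
qed

lemma controlled_ucc_determinant:
  assumes "set qs \<inter> (set is \<union> set ps) = {}"
  shows "controlled_ucc qs is ps \<theta> (axis S 1) =
    (if set qs \<subseteq> S then ucc is ps \<theta> (axis S 1) else axis S 1)"
proof -
  define G where "G = (\<lambda>\<psi>. excitation is ps \<psi> - fock_adjoint (excitation is ps) \<psi>)"
  have G: "G \<psi> \<in> sector K"
    if "\<psi> \<in> sector K" "K = (\<lambda>S. set qs \<subseteq> S) \<or> K = (\<lambda>S. \<not> set qs \<subseteq> S)" for K \<psi>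
    unfolding G_def by (rule sector_generator) (use assms that in auto)
  let ?P = "foldr number_op qs"
  show ?thesis
  proof (cases "set qs \<subseteq> S")
    case True
    have "((\<lambda>\<psi>. \<theta> *\<^sub>R ?P (G \<psi>)) ^^ n) (axis S 1) = ((\<lambda>\<psi>. \<theta> *\<^sub>R G \<psi>) ^^ n) (axis S 1)
        \<and> ((\<lambda>\<psi>. \<theta> *\<^sub>R G \<psi>) ^^ n) (axis S 1) \<in> sector (\<lambda>S. set qs \<subseteq> S)" for n
    proof (induction n)
      case 0
      then show ?case using True by (auto simp: sector_def axis_def)
    next
      case (Suc n)
      let ?\<psi> = "((\<lambda>\<psi>. \<theta> *\<^sub>R G \<psi>) ^^ n) (axis S 1)"
      have "G ?\<psi> \<in> sector (\<lambda>S. set qs \<subseteq> S)" using Suc G by blast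
      moreover from this have "?P (G ?\<psi>) = G ?\<psi>"
        by (auto simp: vec_eq_iff foldr_number_op_nth sector_def)
      ultimately show ?case using Suc by (simp add: sector_def)
    qed
    then show ?thesis using True by (simp add: controlled_ucc_def ucc_def op_exp_def G_def)
  next
    case False
    then have "axis S 1 \<in> sector (\<lambda>S. \<not> set qs \<subseteq> S)" by (auto simp: sector_def axis_def)
    then have "G (axis S 1) \<in> sector (\<lambda>S. \<not> set qs \<subseteq> S)" using G by blast
    then have 1: "?P (G (axis S 1)) = 0"
      by (auto simp: vec_eq_iff foldr_number_op_nth sector_def)
    have G0: "G 0 \<in> sector (\<lambda>S. \<not> set qs \<subseteq> S)" by (rule G) (auto simp: sector_def)
    then have 2: "?P (G 0) = 0"
      by (auto simp: vec_eq_iff foldr_number_op_nth sector_def)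
    have 3: "((\<lambda>\<psi>. \<theta> *\<^sub>R ?P (G \<psi>)) ^^ Suc n) (axis S 1) = 0" for n
    proof (induction n)
      case (Suc n)
      have "((\<lambda>\<psi>. \<theta> *\<^sub>R ?P (G \<psi>)) ^^ Suc (Suc n)) (axis S 1) =
          \<theta> *\<^sub>R ?P (G (((\<lambda>\<psi>. \<theta> *\<^sub>R ?P (G \<psi>)) ^^ Suc n) (axis S 1)))"
        by simp
      then show ?case by (simp only: Suc 2 scaleR_zero_right)
    qed (simp add: 1)
    have "((\<lambda>\<psi>. \<theta> *\<^sub>R ?P (G \<psi>)) ^^ n) (axis S 1) = (if n = 0 then axis S 1 else 0)" for n
      using 3[of "n - 1"] by (cases n) auto
    then have "op_exp (\<lambda>\<psi>. \<theta> *\<^sub>R ?P (G \<psi>)) (axis S 1) =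
        (\<Sum>n. if n = 0 then axis S 1 else 0)"
      unfolding op_exp_def by (intro suminf_cong) simp
    also have "\<dots> = axis S 1"
      using sums_single[of 0 "\<lambda>_. axis S (1::complex)"] sums_unique by metis
    finally show ?thesis using False by (simp add: controlled_ucc_def G_def)
  qed
qed

end

theory Submission
  imports Defs
begin

text \<open>
  The adjoint of an excitation operator is the excitation operator with upper and lower indices
  exchanged. A generator \<open>A - A\<^sup>\<dagger>\<close> therefore acts on the plane spanned by the two determinants it
  exchanges as an infinitesimal rotation, and annihilates every determinant with a vacancy among
  the lower and another among the upper indices. The two outer quarter turns move \<open>|abcde\<rangle>\<close> to
  \<open>|v \<eta>1 x y \<eta>2\<rangle>\<close>, which the controlled factor rotates into \<open>|vwxyz\<rangle>\<close>; all reorderings of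
  creation operators involved are even permutations, so no sign survives. The spectator
  determinants never fill both ancillas, so the quarter turns cancel on them.
\<close>

section \<open>Complex linearity and exponentials of operators\<close>

lemma fock_linearI:
  assumes "\<And>\<phi> \<psi>. T (\<phi> + \<psi>) = T \<phi> + T \<psi>" "\<And>k \<psi>. T (k *s \<psi>) = k *s T \<psi>"
  shows "Vector_Spaces.linear (*s) (*s) (T :: 'o::finite fock \<Rightarrow> 'o fock)"
  by unfold_locales (use assms in auto)

text \<open>Bridges two scalar actions: the exponential series uses real scaling, while linearity on
  Fock space is over the complex numbers.\<close>

lemma scaleR_eq_vector_scalar_mult: "r *\<^sub>R (\<psi> :: 'o::finite fock) = complex_of_real r *s \<psi>"
  by (simp add: vec_eq_iff scaleR_conv_of_real[where 'a = complex])

lemma fock_linear_imp_linear: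
  assumes "Vector_Spaces.linear (*s) (*s) (T :: 'o::finite fock \<Rightarrow> 'o fock)"
  shows "linear T"
proof -
  interpret T: Vector_Spaces.linear "(*s)" "(*s)" T by fact
  show ?thesis by (rule linearI) (simp_all add: T.add T.scale scaleR_eq_vector_scalar_mult)
qed

lemma bounded_linear_vector_scalar_mult:
  "bounded_linear (\<lambda>\<psi>. c *s (\<psi> :: 'o::finite fock))"
  unfolding linear_conv_bounded_linear [symmetric]
  by (rule linearI) (simp_all add: vec_eq_iff algebra_simps)

lemma fock_linear_funpow:
  assumes "Vector_Spaces.linear (*s) (*s) (T :: 'o::finite fock \<Rightarrow> 'o fock)"
  shows "Vector_Spaces.linear (*s) (*s) (T ^^ n)"
proof -
  interpret T: Vector_Spaces.linear "(*s)" "(*s)" T by fact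
  show ?thesis by (rule fock_linearI) (induction n; simp add: T.add T.scale)+
qed

text \<open>Sums and complex multiples pass through the convergent series term by term. This lets a
  product of factors be evaluated one determinant at a time.\<close>

lemma fock_linear_op_exp:
  assumes "Vector_Spaces.linear (*s) (*s) T"
  shows "Vector_Spaces.linear (*s) (*s) (op_exp T)"
proof (rule fock_linearI)
  interpret P: Vector_Spaces.linear "(*s)" "(*s)" "T ^^ n" for n
    using assms by (rule fock_linear_funpow)
  note sums = op_exp_sums[OF fock_linear_imp_linear[OF assms]]
  show "op_exp T (\<phi> + \<psi>) = op_exp T \<phi> + op_exp T \<psi>" for \<phi> \<psi>
    using sums_add[OF sums sums] sums[of "\<phi> + \<psi>"]
    by (simp add: P.add scaleR_add_right sums_unique2)
  show "op_exp T (k *s \<psi>) = k *s op_exp T \<psi>" for k \<psi>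
  proof -
    have "(\<lambda>n. k *s ((T ^^ n) \<psi> /\<^sub>R fact n)) sums (k *s op_exp T \<psi>)"
      by (rule bounded_linear.sums[OF bounded_linear_vector_scalar_mult sums])
    moreover have "k *s ((T ^^ n) \<psi> /\<^sub>R fact n) = (T ^^ n) (k *s \<psi>) /\<^sub>R fact n" for n
      by (simp add: P.scale vec_eq_iff)
    ultimately show ?thesis using sums[of "k *s \<psi>"] by (simp add: sums_unique2)
  qed
qed

lemma op_exp_eq_self:
  assumes "linear T" "T \<psi> = 0"
  shows "op_exp T \<psi> = \<psi>"
proof -
  have "(T ^^ Suc n) \<psi> = 0" for n
    by (induction n) (simp_all add: assms linear_0)
  then have "(T ^^ n) \<psi> /\<^sub>R fact n = (if n = 0 then \<psi> else 0)" for n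
    by (cases n) auto
  then show ?thesis
    using op_exp_sums[OF assms(1), of \<psi>] sums_single[of 0 "\<lambda>_. \<psi>"] by (simp add: sums_unique2)
qed

text \<open>On the span of \<open>\<psi>\<close> and \<open>\<phi>\<close> the operator squares to
  -1, so its powers cycle with period four; even terms sum to the cosine, odd ones to the
  sine.\<close>

lemma op_exp_rotation:
  assumes "linear T" "T \<psi> = \<phi>" "T \<phi> = - \<psi>"
  shows "op_exp (\<lambda>\<psi>. \<theta> *\<^sub>R T \<psi>) \<psi> = cos \<theta> *\<^sub>R \<psi> + sin \<theta> *\<^sub>R \<phi>"
proof -
  have lin: "linear (\<lambda>\<psi>. \<theta> *\<^sub>R T \<psi>)"
    using assms(1) by (rule linear_compose_scale_right)
  \<comment> \<open>\<open>fact n * cos_coeff n\<close> runs through 1, 0, -1, 0 and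
    \<open>fact n * sin_coeff n\<close> through 0, 1, 0, -1. Dividing by \<open>fact n\<close>
    leaves the Taylor series of cosine and sine.\<close>
  have "((\<lambda>\<psi>. \<theta> *\<^sub>R T \<psi>) ^^ n) \<psi>
      = (fact n * cos_coeff n * \<theta> ^ n) *\<^sub>R \<psi> + (fact n * sin_coeff n * \<theta> ^ n) *\<^sub>R \<phi>" for n
  proof (induction n)
    case (Suc n)
    show ?case
      \<comment> \<open>Keeping \<open>of_nat (Suc n)\<close> folded lets the factor from
        \<open>fact (Suc n)\<close> cancel the denominators in \<open>cos_coeff_Suc\<close> and
        \<open>sin_coeff_Suc\<close>.\<close>
      by (simp add: Suc linear_add[OF assms(1)] linear_scale[OF assms(1)] assms(2,3)
          cos_coeff_Suc sin_coeff_Suc scaleR_add_right del: of_nat_Suc)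
        (simp add: mult_ac scaleR_diff_right)
  qed (simp add: cos_coeff_def sin_coeff_def)
  then have "((\<lambda>\<psi>. \<theta> *\<^sub>R T \<psi>) ^^ n) \<psi> /\<^sub>R fact n
      = (cos_coeff n *\<^sub>R \<theta> ^ n) *\<^sub>R \<psi> + (sin_coeff n *\<^sub>R \<theta> ^ n) *\<^sub>R \<phi>" for n
    by (simp add: scaleR_add_right field_simps)
  moreover have "(\<lambda>n. (cos_coeff n *\<^sub>R \<theta> ^ n) *\<^sub>R \<psi> + (sin_coeff n *\<^sub>R \<theta> ^ n) *\<^sub>R \<phi>)
      sums (cos \<theta> *\<^sub>R \<psi> + sin \<theta> *\<^sub>R \<phi>)"
    by (intro sums_add sums_scaleR_left cos_converges sin_converges)
  ultimately show ?thesis using op_exp_sums[OF lin, of \<psi>] by (simp add: sums_unique2)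
qed

section \<open>Linearity and adjoints of products of ladder operators\<close>

lemma annihilate_add: "annihilate p (\<phi> + \<psi>) = annihilate p \<phi> + annihilate p \<psi>"
  and annihilate_scale: "annihilate p (k *s \<psi>) = k *s annihilate p \<psi>"
  by (simp_all add: annihilate_def vec_eq_iff algebra_simps)

lemma create_add: "create p (\<phi> + \<psi>) = create p \<phi> + create p \<psi>"
  and create_scale: "create p (k *s \<psi>) = k *s create p \<psi>"
  by (simp_all add: create_def vec_eq_iff algebra_simps)

lemma annihilate_zero [simp]: "annihilate p 0 = 0"
  and create_zero [simp]: "create p 0 = 0"
  by (simp_all add: annihilate_def create_def vec_eq_iff)

lemma create_uminus: "create p (- \<psi>) = - create p \<psi>"
  using create_scale[of p "-1" \<psi>] by (simp add: vec_eq_iff)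

lemma fock_linear_excitation: "Vector_Spaces.linear (*s) (*s) (excitation is ps)"
proof (rule fock_linearI)
  have "foldr annihilate xs (\<phi> + \<psi>) = foldr annihilate xs \<phi> + foldr annihilate xs \<psi>"
    "foldr create xs (\<phi> + \<psi>) = foldr create xs \<phi> + foldr create xs \<psi>"
    "foldr annihilate xs (k *s \<psi>) = k *s foldr annihilate xs \<psi>"
    "foldr create xs (k *s \<psi>) = k *s foldr create xs \<psi>"
    for xs :: "'a list" and \<phi> \<psi> k
    by (induction xs) (simp_all add: annihilate_add create_add annihilate_scale create_scale)
  then show "excitation is ps (\<phi> + \<psi>) = excitation is ps \<phi> + excitation is ps \<psi>"
    and "excitation is ps (k *s \<psi>) = k *s excitation is ps \<psi>" for \<phi> \<psi> k
    by (simp_all add: excitation_def)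
qed

lemma fock_inner_cnj: "cnj (fock_inner \<phi> \<psi>) = fock_inner \<psi> \<phi>"
  by (simp add: fock_inner_def mult.commute)

lemma fock_inner_annihilate: "fock_inner (annihilate p \<phi>) \<psi> = fock_inner \<phi> (create p \<psi>)"
  using fock_inner_adjoint[OF fock_linearI[of "annihilate p"], OF annihilate_add annihilate_scale]
  by (simp add: fock_adjoint_annihilate)

lemma fock_inner_create: "fock_inner (create p \<phi>) \<psi> = fock_inner \<phi> (annihilate p \<psi>)"
  by (metis fock_inner_annihilate fock_inner_cnj)

text \<open>Pairing with \<open>axis S 1\<close> reads off the amplitude at \<open>S\<close>, so the
  inner products determine the adjoint.\<close>

lemma fock_adjoint_unique:
  assumes "\<And>\<phi> \<psi>. fock_inner (T \<phi>) \<psi> = fock_inner \<phi> (T' \<psi>)"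
  shows "fock_adjoint T = T'"
proof
  fix \<psi>
  have "fock_inner (axis S 1) \<psi>' = \<psi>' $ S" for S :: "'a set" and \<psi>'
  proof -
    have "cnj (axis S 1 $ R) * \<psi>' $ R = (if R = S then \<psi>' $ S else 0)" for R
      by (simp add: axis_def)
    then show ?thesis by (simp add: fock_inner_def)
  qed
  then show "fock_adjoint T \<psi> = T' \<psi>"
    by (simp add: fock_adjoint_def assms vec_eq_iff)
qed

text \<open>Taking adjoints reverses the product and exchanges creators with annihilators.
  \<open>excitation\<close> already lists its annihilators in reverse, so no sign appears.\<close>

lemma fock_adjoint_excitation: "fock_adjoint (excitation is ps) = excitation ps is"
proof (rule fock_adjoint_unique)
  have "fock_inner (foldr create xs \<phi>) \<psi> = fock_inner \<phi> (foldr annihilate (rev xs) \<psi>)"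
    for xs :: "'a list" and \<phi> \<psi>
    by (induction xs arbitrary: \<psi>) (simp_all add: fock_inner_create)
  moreover have "fock_inner (foldr annihilate xs \<phi>) \<psi> = fock_inner \<phi> (foldr create (rev xs) \<psi>)"
    for xs :: "'a list" and \<phi> \<psi>
    by (induction xs arbitrary: \<psi>) (simp_all add: fock_inner_annihilate)
  ultimately show "fock_inner (excitation is ps \<phi>) \<psi> = fock_inner \<phi> (excitation ps is \<psi>)"
    for \<phi> \<psi>
    by (simp add: excitation_def)
qed

section \<open>Action of excitations on determinants\<close>

lemma annihilate_ket_eq_0:
  assumes "p \<notin> set rs"
  shows "annihilate p (ket rs) = 0"
  using assms
proof (induction rs)
  case Nil
  then show ?case by (simp add: ket_def annihilate_vacuum)
next
  case (Cons q rs)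
  then show ?case using annihilate_create_anticommute[of p q "ket rs"] by (simp add: ket_def)
qed

text \<open>Being killed by \<open>annihilate p\<close> survives every further annihilator, so the
  factor for \<open>p\<close> gives zero wherever it stands in the list.\<close>

lemma foldr_annihilate_eq_0:
  assumes "annihilate p \<psi> = 0" "p \<in> set xs"
  shows "foldr annihilate xs \<psi> = 0"
proof -
  have "annihilate p (foldr annihilate ys \<psi>) = 0" for ys
  proof (induction ys)
    case (Cons q ys)
    then show ?case using annihilate_anticommute[of p q "foldr annihilate ys \<psi>"] by simp
  qed (simp add: assms)
  then show ?thesis using assms(2) by (induction xs) auto
qed

lemma foldr_create_zero [simp]: "foldr create ps 0 = 0"
  by (induction ps) auto

lemma excitation_ket_eq_0:
  assumes "\<not> set is \<subseteq> set rs"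
  shows "excitation is ps (ket rs) = 0"
proof -
  obtain i where "i \<in> set is" "i \<notin> set rs" using assms by blast
  then have "foldr annihilate (rev is) (ket rs) = 0"
    by (intro foldr_annihilate_eq_0 annihilate_ket_eq_0) auto
  then show ?thesis by (simp add: excitation_def)
qed

text \<open>The reversed list makes the annihilators act in the order of \<open>is\<close>, each
  meeting its own creator at the head of the ket, so no sign arises.\<close>

lemma excitation_ket:
  assumes "distinct is" "set is \<inter> set rs = {}"
  shows "excitation is ps (ket (is @ rs)) = ket (ps @ rs)"
proof -
  have "foldr annihilate (rev is) (ket (is @ rs)) = ket rs"
    using assms
  proof (induction "is")
    case (Cons i "is")
    then have "annihilate i (ket (is @ rs)) = 0" by (intro annihilate_ket_eq_0) auto
    then have "annihilate i (ket (i # is @ rs)) = ket (is @ rs)"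
      using annihilate_create_anticommute[of i i "ket (is @ rs)"] by (simp add: ket_def)
    then show ?case using Cons by simp
  qed simp
  then show ?thesis by (simp add: excitation_def) (simp add: ket_def)
qed

text \<open>Number operators see only the occupation set, so the order-dependent Jordan-Wigner sign
  never has to be computed.\<close>

lemma ket_in_sector: "ket rs \<in> sector (\<lambda>S. S = set rs)"
proof (induction rs)
  case (Cons p rs)
  have "ket (p # rs) = create p (ket rs)" by (simp add: ket_def)
  moreover have "S - {p} \<noteq> set rs" if "p \<in> S" "S \<noteq> insert p (set rs)" for S
    using that by blast
  ultimately show ?case using Cons by (simp add: sector_def create_def)
qed (simp add: ket_def vacuum_def sector_def axis_def)

lemma foldr_number_op_ket:
  assumes "set qs \<subseteq> set rs"
  shows "foldr number_op qs (ket rs) = ket rs"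
  using ket_in_sector[of rs] assms by (auto simp: vec_eq_iff foldr_number_op_nth sector_def)

text \<open>Exchanging the blocks costs \<open>(- 1) ^ (length xs * length ys)\<close>, which is 1
  as soon as one block has even length.\<close>

lemma ket_append_commute:
  assumes "even (length xs)"
  shows "ket (xs @ ys @ rs) = ket (ys @ xs @ rs)"
proof -
  have pass: "foldr create ys (create p \<psi>) = (- 1) ^ length ys *s create p (foldr create ys \<psi>)"
    for ys :: "'a list" and p \<psi>
  proof (induction ys)
    case (Cons q ys)
    have "create q (create p (foldr create ys \<psi>)) = - create p (create q (foldr create ys \<psi>))"
      using create_anticommute[of q p] by (simp add: eq_neg_iff_add_eq_0)
    then show ?case by (simp add: Cons create_scale vec_eq_iff)
  qed simp
  have swap: "foldr create xs (foldr create ys \<psi>)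
      = (- 1) ^ (length xs * length ys) *s foldr create ys (foldr create xs \<psi>)" for \<psi>
  proof (induction xs)
    case (Cons p xs)
    then show ?case
      by (simp add: pass create_scale power_add minus_one_power_iff)
  qed simp
  show ?thesis using swap[of "foldr create rs vacuum"] assms by (simp add: ket_def)
qed

section \<open>Plain and controlled factors in one form\<close>

definition ucc_generator ::
  "'o::{finite,linorder} list \<Rightarrow> 'o list \<Rightarrow> 'o list \<Rightarrow> 'o fock \<Rightarrow> 'o fock" where
  "ucc_generator qs is ps \<psi> =
    foldr number_op qs (excitation is ps \<psi> - excitation ps is \<psi>)"

text \<open>Replaces the adjoint by the index-swapped excitation and keeps the angle outside, the
  shape that \<open>op_exp_rotation\<close> expects.\<close>

lemma controlled_ucc_eq:
  "controlled_ucc qs is ps \<theta> = op_exp (\<lambda>\<psi>. \<theta> *\<^sub>R ucc_generator qs is ps \<psi>)"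
  by (simp add: controlled_ucc_def ucc_generator_def fock_adjoint_excitation)

text \<open>Lets one family of lemmas cover all five factors and the target exponential.\<close>

lemma ucc_eq_controlled_ucc: "ucc is ps = controlled_ucc [] is ps"
  by (simp add: ucc_def controlled_ucc_def fun_eq_iff)

lemma fock_linear_ucc_generator: "Vector_Spaces.linear (*s) (*s) (ucc_generator qs is ps)"
proof (rule fock_linearI)
  interpret E: Vector_Spaces.linear "(*s)" "(*s)" "excitation is ps" for "is" ps :: "'a list"
    by (rule fock_linear_excitation)
  show "ucc_generator qs is ps (\<phi> + \<psi>) = ucc_generator qs is ps \<phi> + ucc_generator qs is ps \<psi>"
    and "ucc_generator qs is ps (k *s \<psi>) = k *s ucc_generator qs is ps \<psi>" for \<phi> \<psi> k
    by (simp_all add: ucc_generator_def vec_eq_iff foldr_number_op_nth E.add E.scale algebra_simps)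
qed

lemma fock_linear_controlled_ucc: "Vector_Spaces.linear (*s) (*s) (controlled_ucc qs is ps \<theta>)"
  unfolding controlled_ucc_eq
proof (intro fock_linear_op_exp fock_linearI)
  interpret G: Vector_Spaces.linear "(*s)" "(*s)" "ucc_generator qs is ps"
    by (rule fock_linear_ucc_generator)
  show "\<theta> *\<^sub>R ucc_generator qs is ps (\<phi> + \<psi>) =
      \<theta> *\<^sub>R ucc_generator qs is ps \<phi> + \<theta> *\<^sub>R ucc_generator qs is ps \<psi>"
    and "\<theta> *\<^sub>R ucc_generator qs is ps (k *s \<psi>) = k *s (\<theta> *\<^sub>R ucc_generator qs is ps \<psi>)" for \<phi> \<psi> k
    by (simp_all add: G.add G.scale scaleR_add_right vec_eq_iff)
qed

lemma controlled_ucc_add: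
    "controlled_ucc qs is ps \<theta> (\<phi> + \<psi>) = controlled_ucc qs is ps \<theta> \<phi> + controlled_ucc qs is ps \<theta> \<psi>"
  and controlled_ucc_diff:
    "controlled_ucc qs is ps \<theta> (\<phi> - \<psi>) = controlled_ucc qs is ps \<theta> \<phi> - controlled_ucc qs is ps \<theta> \<psi>"
  and controlled_ucc_scale:
    "controlled_ucc qs is ps \<theta> (k *s \<psi>) = k *s controlled_ucc qs is ps \<theta> \<psi>"
proof -
  interpret U: Vector_Spaces.linear "(*s)" "(*s)" "controlled_ucc qs is ps \<theta>"
    by (rule fock_linear_controlled_ucc)
  show "controlled_ucc qs is ps \<theta> (\<phi> + \<psi>) =
      controlled_ucc qs is ps \<theta> \<phi> + controlled_ucc qs is ps \<theta> \<psi>"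
    "controlled_ucc qs is ps \<theta> (\<phi> - \<psi>) =
      controlled_ucc qs is ps \<theta> \<phi> - controlled_ucc qs is ps \<theta> \<psi>"
    "controlled_ucc qs is ps \<theta> (k *s \<psi>) = k *s controlled_ucc qs is ps \<theta> \<psi>"
    by (rule U.add U.diff U.scale)+
qed

text \<open>A vacancy among the lower orbitals kills the excitation and one among the upper orbitals
  kills its adjoint, so the generator vanishes.\<close>

lemma controlled_ucc_ket_eq_self:
  assumes "\<not> set is \<subseteq> set rs" "\<not> set ps \<subseteq> set rs"
  shows "controlled_ucc qs is ps \<theta> (ket rs) = ket rs"
  unfolding controlled_ucc_eq
proof (rule op_exp_eq_self)
  show "linear (\<lambda>\<psi>. \<theta> *\<^sub>R ucc_generator qs is ps \<psi>)"
    by (intro linear_compose_scale_right fock_linear_imp_linear fock_linear_ucc_generator)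
  show "\<theta> *\<^sub>R ucc_generator qs is ps (ket rs) = 0"
    using assms by (simp add: ucc_generator_def excitation_ket_eq_0 vec_eq_iff foldr_number_op_nth)
qed

section \<open>Rotation between \<open>ket (is @ rs)\<close> and \<open>ket (ps @ rs)\<close> with
  spectators \<open>rs\<close>\<close>

context
  fixes "is" ps rs qs :: "'o::{finite,linorder} list"
  assumes dist: "distinct is" "distinct ps"
    and nonempty: "is \<noteq> []" "ps \<noteq> []"
    and disj: "set is \<inter> set ps = {}" "set is \<inter> set rs = {}" "set ps \<inter> set rs = {}"
    and controls: "set qs \<subseteq> set rs"
begin

text \<open>\<open>ps\<close> is nonempty and disjoint from the listed orbitals, so the adjoint part
  vanishes; the controls lie in \<open>rs\<close>, so the number operators fix the result.\<close>

lemma ucc_generator_ket_lower: "ucc_generator qs is ps (ket (is @ rs)) = ket (ps @ rs)"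
proof -
  have "\<not> set ps \<subseteq> set (is @ rs)" using nonempty disj by (cases ps) auto
  then have "excitation ps is (ket (is @ rs)) = 0" by (rule excitation_ket_eq_0)
  moreover have "foldr number_op qs (ket (ps @ rs)) = ket (ps @ rs)"
    using controls by (intro foldr_number_op_ket) auto
  ultimately show ?thesis
    by (simp add: ucc_generator_def excitation_ket[OF dist(1) disj(2)])
qed

text \<open>Here the excitation part vanishes, and the minus sign is the one in front of the
  adjoint.\<close>

lemma ucc_generator_ket_upper: "ucc_generator qs is ps (ket (ps @ rs)) = - ket (is @ rs)"
proof -
  have "\<not> set is \<subseteq> set (ps @ rs)" using nonempty disj by (cases "is") auto
  then have "excitation is ps (ket (ps @ rs)) = 0" by (rule excitation_ket_eq_0)
  moreover have "foldr number_op qs (ket (is @ rs)) = ket (is @ rs)"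
    using controls by (intro foldr_number_op_ket) auto
  moreover have "foldr number_op qs (- \<psi>) = - foldr number_op qs \<psi>" for \<psi>
    by (simp add: vec_eq_iff foldr_number_op_nth)
  ultimately show ?thesis
    by (simp add: ucc_generator_def excitation_ket[OF dist(2) disj(3)])
qed

lemma controlled_ucc_ket_lower:
  "controlled_ucc qs is ps \<theta> (ket (is @ rs)) =
    complex_of_real (cos \<theta>) *s ket (is @ rs) + complex_of_real (sin \<theta>) *s ket (ps @ rs)"
  unfolding controlled_ucc_eq scaleR_eq_vector_scalar_mult[symmetric]
  by (intro op_exp_rotation fock_linear_imp_linear fock_linear_ucc_generator
      ucc_generator_ket_lower ucc_generator_ket_upper)

lemma controlled_ucc_ket_upper:
  "controlled_ucc qs is ps \<theta> (ket (ps @ rs)) =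
    complex_of_real (cos \<theta>) *s ket (ps @ rs) - complex_of_real (sin \<theta>) *s ket (is @ rs)"
proof -
  have lin: "linear (ucc_generator qs is ps)"
    by (intro fock_linear_imp_linear fock_linear_ucc_generator)
  \<comment> \<open>Started at the upper determinant, the rotation has
    \<open>- ket (is @ rs)\<close> as its partner, which flips the sign of the sine.\<close>
  have "op_exp (\<lambda>\<psi>. \<theta> *\<^sub>R ucc_generator qs is ps \<psi>) (ket (ps @ rs)) =
      cos \<theta> *\<^sub>R ket (ps @ rs) + sin \<theta> *\<^sub>R - ket (is @ rs)"
    using lin by (rule op_exp_rotation)
      (simp_all add: ucc_generator_ket_upper linear_neg[OF lin] ucc_generator_ket_lower)
  then show ?thesis
    by (simp add: controlled_ucc_eq scaleR_eq_vector_scalar_mult[symmetric])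
qed

end

section \<open>Evaluation of the five-factor product\<close>

theorem mainTheorem3:
  fixes a b c d e v w x y z \<eta>1 \<eta>2 \<phi>1 \<phi>2 \<phi>3 \<phi>4 \<phi>5 :: "'o::{finite,linorder}"
    and \<theta> :: real
    and \<xi>1 \<xi>2 \<xi>3 \<xi>4 :: complex
    and \<Psi> :: "'o fock"
  assumes "distinct [a, b, c, d, e, v, w, x, y, z, \<eta>1, \<eta>2]"
    and "{\<phi>1, \<phi>2, \<phi>3, \<phi>4, \<phi>5} \<inter> {a, b, c, d, e, v, w, x, y, z, \<eta>1, \<eta>2} = {}"
    and "distinct [\<phi>1, \<phi>2, \<phi>3]"
    and "\<phi>4 \<noteq> \<phi>5"
    and "\<Psi> = \<xi>1 *s ket [a, b, c, d, e] + \<xi>2 *s ket [a, b, \<phi>1, \<phi>2, \<phi>3]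
            + \<xi>3 *s ket [c, d, e, \<phi>4, \<phi>5] + \<xi>4 *s ket [v, w, x, y, z]"
  shows "ucc [v, \<eta>1] [a, b] (pi / 2)
          (ucc [x, y, \<eta>2] [c, d, e] (pi / 2)
            (controlled_ucc [v, x, y] [\<eta>1, \<eta>2] [w, z] \<theta>
              (ucc [c, d, e] [x, y, \<eta>2] (pi / 2)
                (ucc [a, b] [v, \<eta>1] (pi / 2) \<Psi>))))
        = op_exp (\<lambda>\<psi>. \<theta> *\<^sub>R (excitation [a, b, c, d, e] [v, w, x, y, z] \<psi>
            - fock_adjoint (excitation [a, b, c, d, e] [v, w, x, y, z]) \<psi>)) \<Psi>
        \<and> op_exp (\<lambda>\<psi>. \<theta> *\<^sub>R (excitation [a, b, c, d, e] [v, w, x, y, z] \<psi>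
            - fock_adjoint (excitation [a, b, c, d, e] [v, w, x, y, z]) \<psi>)) \<Psi>
        = \<xi>1 *s (complex_of_real (cos \<theta>) *s ket [a, b, c, d, e]
              + complex_of_real (sin \<theta>) *s ket [v, w, x, y, z])
          + \<xi>2 *s ket [a, b, \<phi>1, \<phi>2, \<phi>3]
          + \<xi>3 *s ket [c, d, e, \<phi>4, \<phi>5]
          + \<xi>4 *s (complex_of_real (cos \<theta>) *s ket [v, w, x, y, z]
              - complex_of_real (sin \<theta>) *s ket [a, b, c, d, e])"
proof -
  \<comment> \<open>The simplifier needs each inequality in both orientations; the reversed list and
    the swapped intersection supply the second one.\<close>
  have rev: "distinct (rev [a, b, c, d, e, v, w, x, y, z, \<eta>1, \<eta>2])"
    using assms(1) by (simp only: distinct_rev)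
  have swapped: "{a, b, c, d, e, v, w, x, y, z, \<eta>1, \<eta>2} \<inter> {\<phi>1, \<phi>2, \<phi>3, \<phi>4, \<phi>5} = {}"
    using assms(2) by (simp only: Int_commute)
  note neq = assms(1,2)[simplified] rev[simplified] swapped[simplified]
  have ket1: "ket [v, \<eta>1, c, d, e] = ket [c, d, e, v, \<eta>1]"
    using ket_append_commute[of "[v, \<eta>1]" "[c, d, e]" "[]"] by simp
  \<comment> \<open>Passing one creator over two others costs two signs, which cancel.\<close>
  have create_past: "create p (create q (create r \<psi>)) = create q (create r (create p \<psi>))"
    for p q r :: 'o and \<psi>
    using create_anticommute[of p q "create r \<psi>"] create_anticommute[of p r \<psi>]
    by (simp add: create_uminus eq_neg_iff_add_eq_0[symmetric])
  \<comment> \<open>\<open>\<eta>1\<close> and \<open>\<eta>2\<close> come to the front because the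
    controlled factor empties them, with its controls \<open>v\<close>, \<open>x\<close>,
    \<open>y\<close> as the spectators.\<close>
  have ket2: "ket [x, y, \<eta>2, v, \<eta>1] = ket [\<eta>1, \<eta>2, v, x, y]"
  proof -
    have "ket [x, y, \<eta>2, v, \<eta>1] = ket [v, \<eta>1, x, y, \<eta>2]"
      using ket_append_commute[of "[v, \<eta>1]" "[x, y, \<eta>2]" "[]"] by simp
    also have "\<dots> = ket [v, \<eta>1, \<eta>2, x, y]"
      by (simp add: ket_def create_past[of \<eta>2 x y])
    also have "\<dots> = ket [\<eta>1, \<eta>2, v, x, y]"
      by (simp add: ket_def create_past[of v \<eta>1 \<eta>2])
    finally show ?thesis .
  qed
  \<comment> \<open>Likewise for \<open>w\<close> and \<open>z\<close>, which the controlled factor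
    fills.\<close>
  have ket3: "ket [v, w, x, y, z] = ket [w, z, v, x, y]"
    by (simp add: ket_def create_past[of v w z] create_past[of z x y, symmetric])
  let ?U1 = "controlled_ucc [] [a, b] [v, \<eta>1] (pi / 2)"
    and ?U2 = "controlled_ucc [] [c, d, e] [x, y, \<eta>2] (pi / 2)"
    and ?C = "controlled_ucc [v, x, y] [\<eta>1, \<eta>2] [w, z] \<theta>"
    and ?V2 = "controlled_ucc [] [x, y, \<eta>2] [c, d, e] (pi / 2)"
    and ?V1 = "controlled_ucc [] [v, \<eta>1] [a, b] (pi / 2)"
    and ?W = "controlled_ucc [] [a, b, c, d, e] [v, w, x, y, z] \<theta>"
  note lower = controlled_ucc_ket_lower and upper = controlled_ucc_ket_upper
    and idle = controlled_ucc_ket_eq_self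
  \<comment> \<open>At a quarter turn the cosine is 0 and the sine is 1. \<open>ket1\<close> then
    puts \<open>c\<close>, \<open>d\<close>, \<open>e\<close> in front for the next factor. The last
    two determinants lack an orbital of each index list.\<close>
  have U1: "?U1 (ket [a, b, c, d, e]) = ket [c, d, e, v, \<eta>1]"
    "?U1 (ket [a, b, \<phi>1, \<phi>2, \<phi>3]) = ket [v, \<eta>1, \<phi>1, \<phi>2, \<phi>3]"
    "?U1 (ket [c, d, e, \<phi>4, \<phi>5]) = ket [c, d, e, \<phi>4, \<phi>5]"
    "?U1 (ket [v, w, x, y, z]) = ket [v, w, x, y, z]"
    using lower[of "[a, b]" "[v, \<eta>1]" "[c, d, e]" "[]" "pi / 2"]
      lower[of "[a, b]" "[v, \<eta>1]" "[\<phi>1, \<phi>2, \<phi>3]" "[]" "pi / 2"]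
      idle[of "[a, b]" "[c, d, e, \<phi>4, \<phi>5]" "[v, \<eta>1]" "[]" "pi / 2"]
      idle[of "[a, b]" "[v, w, x, y, z]" "[v, \<eta>1]" "[]" "pi / 2"]
    by (simp_all add: neq ket1)
  \<comment> \<open>\<open>ket [v, w, x, y, z]\<close> stays put because \<open>c\<close> and
    \<open>\<eta>2\<close> are empty; \<open>ket3\<close> only relists it.\<close>
  have U2: "?U2 (ket [c, d, e, v, \<eta>1]) = ket [\<eta>1, \<eta>2, v, x, y]"
    "?U2 (ket [v, \<eta>1, \<phi>1, \<phi>2, \<phi>3]) = ket [v, \<eta>1, \<phi>1, \<phi>2, \<phi>3]"
    "?U2 (ket [c, d, e, \<phi>4, \<phi>5]) = ket [x, y, \<eta>2, \<phi>4, \<phi>5]"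
    "?U2 (ket [v, w, x, y, z]) = ket [w, z, v, x, y]"
    using lower[of "[c, d, e]" "[x, y, \<eta>2]" "[v, \<eta>1]" "[]" "pi / 2"]
      lower[of "[c, d, e]" "[x, y, \<eta>2]" "[\<phi>4, \<phi>5]" "[]" "pi / 2"]
      idle[of "[c, d, e]" "[v, \<eta>1, \<phi>1, \<phi>2, \<phi>3]" "[x, y, \<eta>2]" "[]" "pi / 2"]
      idle[of "[c, d, e]" "[v, w, x, y, z]" "[x, y, \<eta>2]" "[]" "pi / 2"]
    by (simp_all add: neq ket2 ket3)
  \<comment> \<open>The two spectator determinants hold just one ancilla each and neither
    \<open>w\<close> nor \<open>z\<close>, so this factor fixes them.\<close>
  have C: "?C (ket [\<eta>1, \<eta>2, v, x, y]) =
      complex_of_real (cos \<theta>) *s ket [x, y, \<eta>2, v, \<eta>1] + complex_of_real (sin \<theta>) *s ket [v, w, x, y, z]"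
    "?C (ket [v, \<eta>1, \<phi>1, \<phi>2, \<phi>3]) = ket [v, \<eta>1, \<phi>1, \<phi>2, \<phi>3]"
    "?C (ket [x, y, \<eta>2, \<phi>4, \<phi>5]) = ket [x, y, \<eta>2, \<phi>4, \<phi>5]"
    "?C (ket [w, z, v, x, y]) =
      complex_of_real (cos \<theta>) *s ket [v, w, x, y, z] - complex_of_real (sin \<theta>) *s ket [x, y, \<eta>2, v, \<eta>1]"
    using lower[of "[\<eta>1, \<eta>2]" "[w, z]" "[v, x, y]" "[v, x, y]" \<theta>]
      upper[of "[\<eta>1, \<eta>2]" "[w, z]" "[v, x, y]" "[v, x, y]" \<theta>]
      idle[of "[\<eta>1, \<eta>2]" "[v, \<eta>1, \<phi>1, \<phi>2, \<phi>3]" "[w, z]" "[v, x, y]" \<theta>]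
      idle[of "[\<eta>1, \<eta>2]" "[x, y, \<eta>2, \<phi>4, \<phi>5]" "[w, z]" "[v, x, y]" \<theta>]
    by (simp_all add: neq ket2 ket3)
  \<comment> \<open>Undoing a turn exchanges the index lists, so \<open>lower\<close> applies again
    and no minus sign arises.\<close>
  have V2: "?V2 (ket [x, y, \<eta>2, v, \<eta>1]) = ket [v, \<eta>1, c, d, e]"
    "?V2 (ket [v, \<eta>1, \<phi>1, \<phi>2, \<phi>3]) = ket [v, \<eta>1, \<phi>1, \<phi>2, \<phi>3]"
    "?V2 (ket [x, y, \<eta>2, \<phi>4, \<phi>5]) = ket [c, d, e, \<phi>4, \<phi>5]"
    "?V2 (ket [v, w, x, y, z]) = ket [v, w, x, y, z]"
    using lower[of "[x, y, \<eta>2]" "[c, d, e]" "[v, \<eta>1]" "[]" "pi / 2"]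
      lower[of "[x, y, \<eta>2]" "[c, d, e]" "[\<phi>4, \<phi>5]" "[]" "pi / 2"]
      idle[of "[x, y, \<eta>2]" "[v, \<eta>1, \<phi>1, \<phi>2, \<phi>3]" "[c, d, e]" "[]" "pi / 2"]
      idle[of "[x, y, \<eta>2]" "[v, w, x, y, z]" "[c, d, e]" "[]" "pi / 2"]
    by (simp_all add: neq ket1)
  have V1: "?V1 (ket [v, \<eta>1, c, d, e]) = ket [a, b, c, d, e]"
    "?V1 (ket [v, \<eta>1, \<phi>1, \<phi>2, \<phi>3]) = ket [a, b, \<phi>1, \<phi>2, \<phi>3]"
    "?V1 (ket [c, d, e, \<phi>4, \<phi>5]) = ket [c, d, e, \<phi>4, \<phi>5]"
    "?V1 (ket [v, w, x, y, z]) = ket [v, w, x, y, z]"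
    using lower[of "[v, \<eta>1]" "[a, b]" "[c, d, e]" "[]" "pi / 2"]
      lower[of "[v, \<eta>1]" "[a, b]" "[\<phi>1, \<phi>2, \<phi>3]" "[]" "pi / 2"]
      idle[of "[v, \<eta>1]" "[c, d, e, \<phi>4, \<phi>5]" "[a, b]" "[]" "pi / 2"]
      idle[of "[v, \<eta>1]" "[v, w, x, y, z]" "[a, b]" "[]" "pi / 2"]
    by (simp_all add: neq)
  have W: "?W (ket [a, b, c, d, e]) =
      complex_of_real (cos \<theta>) *s ket [a, b, c, d, e] + complex_of_real (sin \<theta>) *s ket [v, w, x, y, z]"
    "?W (ket [a, b, \<phi>1, \<phi>2, \<phi>3]) = ket [a, b, \<phi>1, \<phi>2, \<phi>3]"
    "?W (ket [c, d, e, \<phi>4, \<phi>5]) = ket [c, d, e, \<phi>4, \<phi>5]"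
    "?W (ket [v, w, x, y, z]) =
      complex_of_real (cos \<theta>) *s ket [v, w, x, y, z] - complex_of_real (sin \<theta>) *s ket [a, b, c, d, e]"
    using lower[of "[a, b, c, d, e]" "[v, w, x, y, z]" "[]" "[]" \<theta>]
      upper[of "[a, b, c, d, e]" "[v, w, x, y, z]" "[]" "[]" \<theta>]
      idle[of "[a, b, c, d, e]" "[a, b, \<phi>1, \<phi>2, \<phi>3]" "[v, w, x, y, z]" "[]" \<theta>]
      idle[of "[a, b, c, d, e]" "[c, d, e, \<phi>4, \<phi>5]" "[v, w, x, y, z]" "[]" \<theta>]
    by (simp_all add: neq)
  note linear = controlled_ucc_add controlled_ucc_diff controlled_ucc_scale
  show ?thesis
    \<comment> \<open>Folding \<open>ucc_def\<close> makes the target exponential a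
      \<open>ucc\<close> as well. Every operator is then a \<open>controlled_ucc\<close>, and
      linearity reduces both equations to the values found above.\<close>
    unfolding ucc_def[symmetric] unfolding ucc_eq_controlled_ucc assms(5)
    by (simp only: linear U1 U2 C V2 V1 W simp_thms)
qed

end
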